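(* Let $G$ be a connected graph of order $n\ge 2$. If $\gamma_P(G)\ge\frac n4$, then $\operatorname{th}_{\rm pd}^{\times}(G)=\gamma(G)$.
   Context: All graphs are finite, simple and undirected. Let $G$ be a graph. $\gamma(G)$ is the domination number: the minimum $|S|$ over $S\subseteq V(G)$ with $N[S]=V(G)$, where $N[S]$ is the closed neighborhood of $S$. For nonempty $S\subseteq V(G)$ define $P^{[0]}(S)=S$, $P^{[1]}(S)=N[S]$, and for $i\ge 1$, $P^{[i+1]}(S)=P^{[i]}(S)\cup\{w\in V(G)\setminus P^{[i]}(S): \exists u\in P^{[i]}(S),\ N(u)\setminus P^{[i]}(S)=\{w\}\}$. $S$ is a power dominating set if $P^{[t]}(S)=V(G)$ for some $t$; the power domination number $\gamma_P(G)$ is the minimum cardinality of a power dominating set. The power propagation time $\operatorname{pt}_{\rm pd}(G;S)$ is the least positive integer $t$ with $P^{[t]}(S)=V(G)$ (so it is at least $1$, even for $S=V(G)$), and is $\infty$ if $S$ is not a power dominating set. The product power throttling number is $\operatorname{th}_{\rm pd}^{\times}(G)=\min_{\emptyset\ne S\subseteq V(G)}|S|\operatorname{pt}_{\rm pd}(G;S)$. *)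

theory Defs
  imports Complex_Main "HOL-Library.Extended_Nat" "Graph_Theory.Digraph_Component"
begin

text \<open>
  Finite simple undirected graphs are the library's \<open>graph\<close> locale: finite symmetric digraphs
  without loops or parallel arcs, an edge \<open>uv\<close> being the pair of arcs \<open>(u, v)\<close>, \<open>(v, u)\<close>.
\<close>

definition open_nbhd :: "('a, 'b) pre_digraph \<Rightarrow> 'a \<Rightarrow> 'a set" where
  "open_nbhd G v = {w. v \<rightarrow>\<^bsub>G\<^esub> w}"

definition closed_nbhd :: "('a, 'b) pre_digraph \<Rightarrow> 'a set \<Rightarrow> 'a set" where
  "closed_nbhd G S = S \<union> (\<Union>v\<in>S. open_nbhd G v)"

definition dominating_set :: "('a, 'b) pre_digraph \<Rightarrow> 'a set \<Rightarrow> bool" where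
  "dominating_set G S \<longleftrightarrow> S \<subseteq> verts G \<and> closed_nbhd G S = verts G"

definition domination_number :: "('a, 'b) pre_digraph \<Rightarrow> nat" where
  "domination_number G = Min (card ` {S. dominating_set G S})"

text \<open>The set \<open>P\<^sup>[\<^sup>i\<^sup>](S)\<close> of vertices observed after \<open>i\<close> rounds: one domination step, then
  synchronous zero forcing steps.\<close>

fun observed :: "('a, 'b) pre_digraph \<Rightarrow> 'a set \<Rightarrow> nat \<Rightarrow> 'a set" where
  "observed G S 0 = S"
| "observed G S (Suc 0) = closed_nbhd G S"
| "observed G S (Suc (Suc i)) = observed G S (Suc i) \<union>
     {w \<in> verts G - observed G S (Suc i).
        \<exists>u \<in> observed G S (Suc i). open_nbhd G u - observed G S (Suc i) = {w}}"

definition power_dominating_set :: "('a, 'b) pre_digraph \<Rightarrow> 'a set \<Rightarrow> bool" where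
  "power_dominating_set G S \<longleftrightarrow>
     S \<noteq> {} \<and> S \<subseteq> verts G \<and> (\<exists>t. observed G S t = verts G)"

definition power_domination_number :: "('a, 'b) pre_digraph \<Rightarrow> nat" where
  "power_domination_number G = Min (card ` {S. power_dominating_set G S})"

definition power_propagation_time :: "('a, 'b) pre_digraph \<Rightarrow> 'a set \<Rightarrow> enat" where
  "power_propagation_time G S =
     (if power_dominating_set G S
      then enat (LEAST t. 0 < t \<and> observed G S t = verts G)
      else \<infinity>)"

definition product_power_throttling_number :: "('a, 'b) pre_digraph \<Rightarrow> enat" where
  "product_power_throttling_number G =
     Min ((\<lambda>S. enat (card S) * power_propagation_time G S) ` {S. S \<noteq> {} \<and> S \<subseteq> verts G})"

end

theory Submission
  imports Defs
begin

text \<open>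
  A dominating set is a power dominating set with propagation time \<open>1\<close>, so the throttling number
  is at most \<open>\<gamma>(G)\<close>. Conversely, if \<open>S\<close> has propagation time \<open>1\<close> then it is dominating, and if its
  propagation time is at least \<open>2\<close> then the product is at least \<open>2 \<gamma>\<^sub>P(G) \<ge> n / 2\<close>, which is at
  least \<open>\<gamma>(G)\<close> by Ore's bound for graphs without isolated vertices.
\<close>

context fin_digraph
begin

text \<open>Arcs end in vertices, so the closed neighbourhood of a subset of \<open>verts G\<close>
  stays inside \<open>verts G\<close>; only covering the vertices outside \<open>S\<close>
  remains.\<close>

lemma dominating_set_iff:
  "dominating_set G S \<longleftrightarrow> S \<subseteq> verts G \<and> (\<forall>w \<in> verts G - S. \<exists>v \<in> S. v \<rightarrow>\<^bsub>G\<^esub> w)"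
  unfolding dominating_set_def closed_nbhd_def open_nbhd_def
  by (auto dest: adj_in_verts)

lemma finite_dominating_sets: "finite {S. dominating_set G S}"
  by (rule finite_subset[of _ "Pow (verts G)"]) (auto simp: dominating_set_def)

lemma domination_number_le: "dominating_set G S \<Longrightarrow> domination_number G \<le> card S"
  unfolding domination_number_def using finite_dominating_sets by (intro Min_le) auto

lemma domination_number_attained:
  obtains S where "dominating_set G S" "card S = domination_number G"
proof -
  \<comment> \<open>The full vertex set makes the family nonempty, as \<open>Min_in\<close>
    demands.\<close>
  have "dominating_set G (verts G)"
    by (simp add: dominating_set_iff)
  then have "domination_number G \<in> card ` {S. dominating_set G S}"
    unfolding domination_number_def using finite_dominating_sets by (intro Min_in) auto
  then show ?thesis using that by auto
qed

lemma power_domination_number_le: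
  assumes "power_dominating_set G S"
  shows "power_domination_number G \<le> card S"
proof -
  have "finite {S. power_dominating_set G S}"
    by (rule finite_subset[of _ "Pow (verts G)"]) (auto simp: power_dominating_set_def)
  with assms show ?thesis
    unfolding power_domination_number_def by (intro Min_le) auto
qed

lemma power_propagation_time_dominating:
  assumes "dominating_set G S" "S \<noteq> {}"
  shows "power_propagation_time G S = 1"
proof -
  have obs: "observed G S (Suc 0) = verts G" and "S \<subseteq> verts G"
    using assms(1) by (auto simp: dominating_set_def)
  then have "power_dominating_set G S"
    using assms(2) unfolding power_dominating_set_def by blast
  moreover have "(LEAST t. 0 < t \<and> observed G S t = verts G) = Suc 0"
    using obs by (intro Least_equality) auto
  ultimately show ?thesis
    by (simp add: power_propagation_time_def one_enat_def)
qed

text \<open>Round 1 is the domination step itself, so it cannot finish; a set that is not power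
  dominating has time \<open>\<infinity>\<close>.\<close>

lemma power_propagation_time_not_dominating:
  assumes "\<not> dominating_set G S"
  shows "2 \<le> power_propagation_time G S"
proof (cases "power_dominating_set G S")
  case True
  then obtain t where t: "observed G S t = verts G" and S: "S \<subseteq> verts G"
    by (auto simp: power_dominating_set_def)
  \<comment> \<open>\<open>LEAST\<close> ranges over positive times, so a positive witness is
    required; at time 0, \<open>S\<close> would be all of \<open>verts G\<close> and hence
    dominating.\<close>
  have "t \<noteq> 0"
    using assms t by (cases t) (auto simp: dominating_set_iff)
  have "2 \<le> u" if "0 < u \<and> observed G S u = verts G" for u
  proof -
    have "u \<noteq> Suc 0"
      using that assms S by (auto simp: dominating_set_def)
    with that show ?thesis by linarith
  qed
  then have "2 \<le> (LEAST t. 0 < t \<and> observed G S t = verts G)"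
    using t \<open>t \<noteq> 0\<close> by (metis (mono_tags, lifting) LeastI neq0_conv)
  with True show ?thesis
    by (simp add: power_propagation_time_def numeral_eq_enat)
qed (simp add: power_propagation_time_def)

lemma product_power_throttling_number_attained:
  assumes "verts G \<noteq> {}"
  obtains S where "S \<noteq> {}" "S \<subseteq> verts G"
    "product_power_throttling_number G = enat (card S) * power_propagation_time G S"
proof -
  let ?f = "\<lambda>S. enat (card S) * power_propagation_time G S"
  have "finite {S. S \<noteq> {} \<and> S \<subseteq> verts G}" by simp
  then have "product_power_throttling_number G \<in> ?f ` {S. S \<noteq> {} \<and> S \<subseteq> verts G}"
    unfolding product_power_throttling_number_def using assms by (intro Min_in) auto
  then show ?thesis using that by auto
qed

lemma product_power_throttling_number_le:
  assumes "S \<noteq> {}" "S \<subseteq> verts G"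
  shows "product_power_throttling_number G \<le> enat (card S) * power_propagation_time G S"
  unfolding product_power_throttling_number_def using assms by (intro Min_le) auto

lemma product_power_throttling_number_le_domination_number:
  assumes "verts G \<noteq> {}"
  shows "product_power_throttling_number G \<le> enat (domination_number G)"
proof -
  obtain S where S: "dominating_set G S" "card S = domination_number G"
    by (rule domination_number_attained)
  \<comment> \<open>The throttling minimum ranges over nonempty sets only; the empty set cannot
    dominate a nonempty graph.\<close>
  then have "S \<noteq> {}" "S \<subseteq> verts G"
    using assms by (auto simp: dominating_set_iff)
  then show ?thesis
    using product_power_throttling_number_le[of S] power_propagation_time_dominating[of S] S
    by simp
qed

end

text \<open>Ore's bound: the complement of a minimum dominating set \<open>D\<close> dominates too, since a vertex of
  \<open>D\<close> with all its neighbours in \<open>D\<close> could be removed from \<open>D\<close>.\<close>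

lemma (in graph) domination_number_le_half:
  assumes no_isolated: "\<And>v. v \<in> verts G \<Longrightarrow> \<exists>u. v \<rightarrow>\<^bsub>G\<^esub> u"
  shows "2 * domination_number G \<le> card (verts G)"
proof -
  obtain D where D: "dominating_set G D" "card D = domination_number G"
    by (rule domination_number_attained)
  have sub: "D \<subseteq> verts G" using D(1) by (simp add: dominating_set_def)
  then have fin: "finite D" by (rule finite_subset) simp
  have "dominating_set G (verts G - D)"
  proof (rule ccontr)
    assume "\<not> dominating_set G (verts G - D)"
    then obtain v where v: "v \<in> D" and nbrs: "\<And>u. u \<in> verts G - D \<Longrightarrow> \<not> u \<rightarrow>\<^bsub>G\<^esub> v"
      using sub by (auto simp: dominating_set_iff)
    obtain u where u: "v \<rightarrow>\<^bsub>G\<^esub> u"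
      using no_isolated v sub by blast
    then have uv: "u \<rightarrow>\<^bsub>G\<^esub> v" by (rule graph_symmetric)
    then have "u \<in> D" "u \<noteq> v"
      using nbrs adj_in_verts adj_not_same by blast+
    have "dominating_set G (D - {v})"
      unfolding dominating_set_iff
    proof (intro conjI ballI)
      fix w assume w: "w \<in> verts G - (D - {v})"
      show "\<exists>x \<in> D - {v}. x \<rightarrow>\<^bsub>G\<^esub> w"
      proof (cases "w = v")
        case True
        with uv \<open>u \<in> D\<close> \<open>u \<noteq> v\<close> show ?thesis by blast
      next
        case False
        with w D(1) obtain x where "x \<in> D" "x \<rightarrow>\<^bsub>G\<^esub> w"
          by (auto simp: dominating_set_iff)
        \<comment> \<open>If \<open>x\<close> were \<open>v\<close>, then \<open>w\<close>, which
          lies outside \<open>D\<close>, would be a neighbour of \<open>v\<close>, against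
          \<open>nbrs\<close>.\<close>
        moreover have "x \<noteq> v"
          using nbrs[of w] graph_symmetric w False calculation by blast
        ultimately show ?thesis by blast
      qed
    qed (use sub in blast)
    then have "domination_number G \<le> card (D - {v})"
      by (rule domination_number_le)
    with D(2) card_Diff1_less[OF fin v] show False by simp
  qed
  then have "domination_number G \<le> card (verts G - D)"
    by (rule domination_number_le)
  also have "\<dots> = card (verts G) - card D"
    using fin sub by (rule card_Diff_subset)
  \<comment> \<open>The subtraction is on naturals; \<open>D\<close> being a subset of
    \<open>verts G\<close> rules out truncation.\<close>
  finally show ?thesis
    using D(2) card_mono[OF finite_verts sub] by simp
qed

text \<open>\<open>connected\<close> speaks of the symmetric closure, which for a symmetric digraph
  has the same reachability; a walk from \<open>v\<close> to a second vertex starts with an arc out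
  of \<open>v\<close>.\<close>

lemma (in graph) connected_no_isolated:
  assumes "connected G" "card (verts G) \<ge> 2" "v \<in> verts G"
  shows "\<exists>u. v \<rightarrow>\<^bsub>G\<^esub> u"
proof -
  have "\<not> verts G \<subseteq> {v}"
    using assms(2) card_mono[of "{v}" "verts G"] by auto
  then obtain w where w: "w \<in> verts G" "w \<noteq> v" by blast
  have "v \<rightarrow>\<^sup>*\<^bsub>mk_symmetric G\<^esub> w"
    using assms(1,3) w by (auto simp: connected_def strongly_connected_def)
  then have "v \<rightarrow>\<^sup>* w"
    by (simp only: reachable_mk_symmetric_eq[OF sym_arcs])
  then show ?thesis
    using w(2) by (cases rule: converse_reachable_cases) auto
qed

theorem corollary3p10:
  fixes G :: "('a, 'b) pre_digraph"
  assumes "Digraph.graph G"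
    and "Digraph_Component.connected G"
    and "card (verts G) \<ge> 2"
    and "real (power_domination_number G) \<ge> real (card (verts G)) / 4"
  shows "product_power_throttling_number G = enat (domination_number G)"
proof (rule antisym)
  interpret graph G by fact
  have ne: "verts G \<noteq> {}" using assms(3) by auto
  then show "product_power_throttling_number G \<le> enat (domination_number G)"
    by (rule product_power_throttling_number_le_domination_number)
  obtain S where S: "S \<noteq> {}" "S \<subseteq> verts G"
    and th: "product_power_throttling_number G = enat (card S) * power_propagation_time G S"
    using ne by (rule product_power_throttling_number_attained)
  consider "dominating_set G S" | "\<not> dominating_set G S" "power_dominating_set G S"
    | "\<not> power_dominating_set G S" by blast
  then show "enat (domination_number G) \<le> product_power_throttling_number G"
  proof cases
    case 1
    then show ?thesis
      using th S domination_number_le power_propagation_time_dominating by simp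
  next
    case 2
    have "2 * domination_number G \<le> card (verts G)"
      using domination_number_le_half connected_no_isolated assms(2,3) by blast
    \<comment> \<open>With n the order of \<open>G\<close>, the chain is \<gamma> \<le> n/2 \<le> 2
      \<gamma>_P \<le> 2 |S|.\<close>
    with assms(4) power_domination_number_le[OF 2(2)] have "domination_number G \<le> card S * 2"
      by linarith
    then have "enat (domination_number G) \<le> enat (card S) * 2"
      by (simp add: numeral_eq_enat)
    also have "\<dots> \<le> enat (card S) * power_propagation_time G S"
      using power_propagation_time_not_dominating[OF 2(1)] by (rule mult_left_mono) simp
    finally show ?thesis using th by simp
  next
    case 3
    \<comment> \<open>In \<open>enat\<close> the product \<open>0 * \<infinity>\<close> is
      \<open>0\<close>, so the product is infinite only once \<open>card S\<close> is known to be
      nonzero.\<close>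
    have "card S \<noteq> 0"
      using S finite_subset[OF S(2)] by simp
    with 3 show ?thesis
      by (simp add: th power_propagation_time_def)
  qed
qed

end
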